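(* The equational theories $E_{\mathrm{Md}}$ (axioms of meadows, with inverse operator ${}^{-1}$) and $E_{\mathrm{NiMd1}}$ (axioms of one-based non-involutive meadows, with inverse operator ${}^{\sim}$) are definitionally equivalent, i.e. $$E_{\mathrm{Md}} \cup \{x^{\sim} = x^{-1} + (1 - x\cdot x^{-1})\} \vdash E_{\mathrm{NiMd1}} \cup \{x^{-1} = x\cdot(x^{\sim}\cdot x^{\sim})\}$$ and $$E_{\mathrm{NiMd1}} \cup \{x^{-1} = x\cdot(x^{\sim}\cdot x^{\sim})\} \vdash E_{\mathrm{Md}} \cup \{x^{\sim} = x^{-1} + (1 - x\cdot x^{-1})\}.$$
   Context: All equations are understood with universally quantified variables, and $\vdash$ denotes derivability (in equational logic) of every equation on the right from the set of equations on the left, over the signature $\{0,1,+,\cdot,-,{}^{-1},{}^{\sim}\}$ with constants $0,1$, binary $+,\cdot$, unary additive inverse $-$, and unary postfix operators ${}^{-1}$ and ${}^{\sim}$. $p-q$ abbreviates $p+(-q)$. $E_{\mathrm{CR}}$ is the set of the usual equations of a commutative ring with multiplicative identity (the equality $0=1$ is not excluded): $(x+y)+z=x+(y+z)$, $x+y=y+x$, $x+0=x$, $x+(-x)=0$, $(x\cdot y)\cdot z=x\cdot(y\cdot z)$, $x\cdot y=y\cdot x$, $x\cdot 1=x$, $x\cdot(y+z)=x\cdot y+x\cdot z$. $E_{\mathrm{Md}}$ is $E_{\mathrm{CR}}$ together with $(x^{-1})^{-1}=x$ and $x\cdot(x\cdot x^{-1})=x$. $E_{\mathrm{NiMd1}}$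 is $E_{\mathrm{CR}}$ together with the four equations $(x^{\sim})^{\sim}=x+(1-x\cdot x^{\sim})$, $x\cdot(x\cdot x^{\sim})=x$, $x^{\sim}\cdot(x^{\sim})^{\sim}=1$, and $(x\cdot(x^{\sim}\cdot x^{\sim}))^{\sim}\cdot(x\cdot x^{\sim})=x$. *)

theory Defs
  imports Main
begin

datatype tm =
    Var nat
  | Zero ("\<zero>")
  | One ("\<one>")
  | Add tm tm (infixl "\<oplus>" 65)
  | Mul tm tm (infixl "\<otimes>" 70)
  | Neg tm ("(\<ominus> _)" [81] 80)
  | Inv tm ("(_\<inverse>)" [1000] 999)
  | Tilde tm ("(_\<^sup>\<sim>)" [1000] 999)

abbreviation Sub :: "tm \<Rightarrow> tm \<Rightarrow> tm" (infixl "\<ominus>" 65)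
  where "p \<ominus> q \<equiv> p \<oplus> (\<ominus> q)"

type_synonym equation = "tm \<times> tm"

abbreviation Equation :: "tm \<Rightarrow> tm \<Rightarrow> equation" (infix "\<approx>" 50)
  where "s \<approx> t \<equiv> (s, t)"

primrec subst :: "(nat \<Rightarrow> tm) \<Rightarrow> tm \<Rightarrow> tm" where
  "subst \<sigma> (Var n) = \<sigma> n"
| "subst \<sigma> \<zero> = \<zero>"
| "subst \<sigma> \<one> = \<one>"
| "subst \<sigma> (s \<oplus> t) = subst \<sigma> s \<oplus> subst \<sigma> t"
| "subst \<sigma> (s \<otimes> t) = subst \<sigma> s \<otimes> subst \<sigma> t"
| "subst \<sigma> (\<ominus> t) = \<ominus> (subst \<sigma> t)"
| "subst \<sigma> (t\<inverse>) = (subst \<sigma> t)\<inverse>"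
| "subst \<sigma> (t\<^sup>\<sim>) = (subst \<sigma> t)\<^sup>\<sim>"

text \<open>Derivability in equational logic. The variables of an axiom are implicitly universally
  quantified; this is what the rule \<open>inst\<close> expresses.\<close>

inductive derivable :: "equation set \<Rightarrow> equation \<Rightarrow> bool" for E :: "equation set" where
  ax: "e \<in> E \<Longrightarrow> derivable E e"
| refl: "derivable E (t \<approx> t)"
| sym: "derivable E (s \<approx> t) \<Longrightarrow> derivable E (t \<approx> s)"
| trans: "derivable E (s \<approx> t) \<Longrightarrow> derivable E (t \<approx> u) \<Longrightarrow> derivable E (s \<approx> u)"
| inst: "derivable E (s \<approx> t) \<Longrightarrow> derivable E (subst \<sigma> s \<approx> subst \<sigma> t)"
| cong_Add: "derivable E (s \<approx> s') \<Longrightarrow> derivable E (t \<approx> t') \<Longrightarrow> derivable E (s \<oplus> t \<approx> s' \<oplus> t')"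
| cong_Mul: "derivable E (s \<approx> s') \<Longrightarrow> derivable E (t \<approx> t') \<Longrightarrow> derivable E (s \<otimes> t \<approx> s' \<otimes> t')"
| cong_Neg: "derivable E (t \<approx> t') \<Longrightarrow> derivable E (\<ominus> t \<approx> \<ominus> t')"
| cong_Inv: "derivable E (t \<approx> t') \<Longrightarrow> derivable E (t\<inverse> \<approx> t'\<inverse>)"
| cong_Tilde: "derivable E (t \<approx> t') \<Longrightarrow> derivable E (t\<^sup>\<sim> \<approx> t'\<^sup>\<sim>)"

definition entails :: "equation set \<Rightarrow> equation set \<Rightarrow> bool" (infix "\<turnstile>" 40)
  where "E \<turnstile> F \<longleftrightarrow> (\<forall>e \<in> F. derivable E e)"

abbreviation "vx \<equiv> Var 0"
abbreviation "vy \<equiv> Var 1"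
abbreviation "vz \<equiv> Var 2"

definition E_CR :: "equation set" where
  "E_CR =
    { (vx \<oplus> vy) \<oplus> vz \<approx> vx \<oplus> (vy \<oplus> vz),
      vx \<oplus> vy \<approx> vy \<oplus> vx,
      vx \<oplus> \<zero> \<approx> vx,
      vx \<oplus> (\<ominus> vx) \<approx> \<zero>,
      (vx \<otimes> vy) \<otimes> vz \<approx> vx \<otimes> (vy \<otimes> vz),
      vx \<otimes> vy \<approx> vy \<otimes> vx,
      vx \<otimes> \<one> \<approx> vx,
      vx \<otimes> (vy \<oplus> vz) \<approx> vx \<otimes> vy \<oplus> vx \<otimes> vz }"

definition E_Md :: "equation set" where
  "E_Md = E_CR \<union>
    { (vx\<inverse>)\<inverse> \<approx> vx,
      vx \<otimes> (vx \<otimes> vx\<inverse>) \<approx> vx }"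

definition E_NiMd1 :: "equation set" where
  "E_NiMd1 = E_CR \<union>
    { (vx\<^sup>\<sim>)\<^sup>\<sim> \<approx> vx \<oplus> (\<one> \<ominus> vx \<otimes> vx\<^sup>\<sim>),
      vx \<otimes> (vx \<otimes> vx\<^sup>\<sim>) \<approx> vx,
      vx\<^sup>\<sim> \<otimes> (vx\<^sup>\<sim>)\<^sup>\<sim> \<approx> \<one>,
      (vx \<otimes> (vx\<^sup>\<sim> \<otimes> vx\<^sup>\<sim>))\<^sup>\<sim> \<otimes> (vx \<otimes> vx\<^sup>\<sim>) \<approx> vx }"

end

theory Submission
  imports Defs
begin

text \<open>
  Derivability from an equation set is equality in its term algebra (terms modulo derivability),
  so it suffices to compute in an arbitrary commutative ring with one. For \<open>x\<close> with meadow inverse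
  \<open>i\<close>, the element \<open>e = x i\<close> is idempotent; \<open>i\<close> inverts \<open>x\<close> on the part of the ring cut out by \<open>e\<close>
  and vanishes on the part cut out by \<open>1 - e\<close>. The one-based inverse is \<open>i + (1 - e)\<close>, a unit with
  inverse \<open>x + (1 - e)\<close>, and multiplication by \<open>e\<close> recovers \<open>i\<close> from it.
\<close>

section \<open>Meadows as rings with an operation\<close>

text \<open>The class \<open>comm_ring_1\<close> is not used, because it imposes \<open>0 \<noteq> 1\<close>.\<close>

locale meadow =
  fixes inv :: "'a :: {comm_ring, comm_monoid_mult} \<Rightarrow> 'a"
  assumes inv_inv: "inv (inv x) = x"
    and mult_mult_inv: "x * (x * inv x) = x"
begin

lemma inv_mult_mult: "inv x * (inv x * x) = inv x"
  using mult_mult_inv[of "inv x"] by (simp add: inv_inv)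

text \<open>Multiplying \<open>x * (x * inv x) = x\<close> by \<open>y\<close> cancels a factor
  \<open>x\<close> and yields \<open>x * inv x = 1\<close>; inverses in a commutative monoid are
  unique.\<close>

lemma inv_unique:
  assumes "x * y = 1"
  shows "inv x = y"
proof -
  have "x * inv x = x * (x * inv x) * y"
    using assms by (metis mult.assoc mult.commute mult_1_right)
  then have "x * inv x = 1"
    using assms by (simp add: mult_mult_inv)
  then show ?thesis
    using assms by (metis mult.assoc mult.commute mult_1_right)
qed

definition one_based :: "'a \<Rightarrow> 'a"
  where "one_based x = inv x + (1 - x * inv x)"

lemma mult_one_based: "x * one_based x = x * inv x"
  using mult_mult_inv[of x] by (simp add: one_based_def algebra_simps)

text \<open>Split both factors along the idempotent \<open>x * inv x\<close> and its complement: the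
  cross terms vanish, and the two remaining products are these two idempotents, which sum to
  1.\<close>

lemma one_based_mult_unit: "one_based x * (x + (1 - x * inv x)) = 1"
proof -
  have 1: "x * (x * inv x) = x" and 2: "inv x * (x * inv x) = inv x"
    using mult_mult_inv[of x] inv_mult_mult[of x] by (simp_all add: mult_ac)
  have 3: "x * (inv x * (x * inv x)) = x * inv x"
    by (simp add: 2)
  show ?thesis
    using 1 2 3 by (simp add: one_based_def algebra_simps)
qed

text \<open>Since \<open>one_based x\<close> is a unit, \<open>inv_unique\<close> computes its
  meadow inverse, and the correction term in the outer \<open>one_based\<close> is 0.\<close>

lemma one_based_one_based: "one_based (one_based x) = x + (1 - x * one_based x)"
  using inv_unique[OF one_based_mult_unit[of x]] one_based_mult_unit[of x]
  by (simp add: one_based_def[of "one_based x"] mult_one_based)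

lemma one_based_mult_one_based: "one_based x * one_based (one_based x) = 1"
  using one_based_mult_unit[of x] by (simp add: one_based_one_based mult_one_based)

text \<open>Next to a factor \<open>x\<close>, \<open>one_based x\<close> may be traded for
  \<open>inv x\<close>; doing this twice leaves \<open>inv x * (inv x * x)\<close>.\<close>

lemma inv_eq_one_based: "inv x = x * (one_based x * one_based x)"
proof -
  have "x * (one_based x * one_based x) = inv x * (x * one_based x)"
    by (metis mult.assoc mult.commute mult_one_based)
  also have "\<dots> = inv x * (inv x * x)"
    by (simp add: mult_one_based mult.commute)
  finally show ?thesis
    by (simp add: inv_mult_mult)
qed

lemma one_based_inv_mult:
  "one_based (x * (one_based x * one_based x)) * (x * one_based x) = x"
proof -
  have 1: "x * (x * inv x) = x"
    by (rule mult_mult_inv)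
  have 2: "x * (x * (inv x * inv x)) = x * inv x"
    using 1 by (metis mult.assoc)
  show ?thesis
    \<comment> \<open>The goal becomes \<open>one_based (inv x) * (x * inv x) = x\<close>: the
      idempotent annihilates the complementary part of \<open>one_based (inv x)\<close> and keeps
      \<open>x\<close>.\<close>
    unfolding inv_eq_one_based[symmetric] mult_one_based
    using 1 2 by (simp add: one_based_def inv_inv algebra_simps)
qed

end

locale one_based_meadow =
  fixes til :: "'a :: {comm_ring, comm_monoid_mult} \<Rightarrow> 'a"
  assumes til_til: "til (til x) = x + (1 - x * til x)"
    and mult_mult_til: "x * (x * til x) = x"
    and til_mult_til_til: "til x * til (til x) = 1"
    and til_inverse_mult: "til (x * (til x * til x)) * (x * til x) = x"
begin

text \<open>Best read as \<open>(x * til x) * til x\<close>: the idempotent \<open>x * til x\<close>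
  cuts the complementary part off \<open>til x\<close>.\<close>

definition involutive :: "'a \<Rightarrow> 'a"
  where "involutive x = x * (til x * til x)"

lemma mult_involutive: "x * involutive x = x * til x"
  using mult_mult_til[of x] unfolding involutive_def by (metis mult.assoc)

lemma mult_mult_involutive: "x * (x * involutive x) = x"
  by (simp add: mult_involutive mult_mult_til)

text \<open>Inserting \<open>til_til\<close> into \<open>til_mult_til_til\<close> and expanding
  gives an equation linear in \<open>involutive x\<close>, which is solved for
  \<open>til x\<close>.\<close>

lemma til_eq_involutive: "til x = involutive x + (1 - x * involutive x)"
proof -
  have "til x * (x + (1 - x * til x)) = 1"
    using til_mult_til_til[of x] by (simp add: til_til)
  then have "x * til x + til x - involutive x = 1"
    by (simp add: involutive_def algebra_simps)
  then show ?thesis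
    unfolding mult_involutive by (metis add_diff_cancel_left' add.commute add_diff_eq diff_add_cancel)
qed

lemma involutive_involutive: "involutive (involutive x) = x"
proof -
  let ?i = "involutive x" and ?e = "x * til x"
  have e: "?i * ?e = ?i"
    using mult_mult_til[of x] unfolding involutive_def by (metis mult.assoc mult.commute)
  have t: "til ?i * ?e = x"
    using til_inverse_mult[of x] by (simp add: involutive_def)
  \<comment> \<open>As \<open>?i\<close> absorbs \<open>?e\<close>, two copies of \<open>?e\<close>
    can be inserted, one for each factor \<open>til ?i\<close>; by \<open>t\<close> each pair
    collapses to \<open>x\<close>.\<close>
  have "involutive ?i = (?i * ?e * ?e) * (til ?i * til ?i)"
    by (simp only: e involutive_def[of ?i])
  also have "\<dots> = ?i * ((til ?i * ?e) * (til ?i * ?e))"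
    by (simp only: mult_ac)
  also have "\<dots> = x * (x * ?i)"
    unfolding t by (simp only: mult_ac)
  finally show ?thesis
    by (simp add: mult_mult_involutive)
qed

end

section \<open>Term algebras\<close>

text \<open>Types cannot depend on an equation set, so the equation set is attached to a phantom type.\<close>

class ring_theory =
  fixes axs :: "'a itself \<Rightarrow> equation set"
  assumes E_CR_subset: "E_CR \<subseteq> axs TYPE('a)"

quotient_type (overloaded) 'a term_class =
  tm / "\<lambda>s t. derivable (axs TYPE('a :: ring_theory)) (s \<approx> t)"
  by (rule equivpI)
    (auto intro!: reflpI sympI transpI intro: derivable.refl derivable.sym derivable.trans)

lemma derivable_inst:
  assumes "(s, t) \<in> E"
  shows "derivable E (subst \<sigma> s, subst \<sigma> t)"
  using assms by (intro derivable.inst derivable.ax)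

text \<open>These instances at arbitrary terms are what \<open>transfer\<close> makes of the ring
  laws for \<open>term_class\<close>.\<close>

lemma derivable_CR:
  assumes "E_CR \<subseteq> E"
  shows "derivable E ((a \<oplus> b) \<oplus> c \<approx> a \<oplus> (b \<oplus> c))"
    and "derivable E (a \<oplus> b \<approx> b \<oplus> a)"
    and "derivable E (a \<oplus> \<zero> \<approx> a)"
    and "derivable E (a \<oplus> (\<ominus> a) \<approx> \<zero>)"
    and "derivable E ((a \<otimes> b) \<otimes> c \<approx> a \<otimes> (b \<otimes> c))"
    and "derivable E (a \<otimes> b \<approx> b \<otimes> a)"
    and "derivable E (a \<otimes> \<one> \<approx> a)"
    and "derivable E (a \<otimes> (b \<oplus> c) \<approx> a \<otimes> b \<oplus> a \<otimes> c)"
proof -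
  \<comment> \<open>The substitution sends \<open>vx\<close>, \<open>vy\<close>, \<open>vz\<close>
    to \<open>a\<close>, \<open>b\<close>, \<open>c\<close>; its value \<open>c\<close> beyond
    \<open>vz\<close> is arbitrary, as the axioms have no further variables.\<close>
  have *: "derivable E (subst (\<lambda>n. if n = 0 then a else if n = 1 then b else c) s,
      subst (\<lambda>n. if n = 0 then a else if n = 1 then b else c) t)" if "(s, t) \<in> E_CR" for s t
    using that assms by (intro derivable_inst) auto
  show "derivable E ((a \<oplus> b) \<oplus> c \<approx> a \<oplus> (b \<oplus> c))"
    using *[of "(vx \<oplus> vy) \<oplus> vz" "vx \<oplus> (vy \<oplus> vz)"] by (simp add: E_CR_def)
  show "derivable E (a \<oplus> b \<approx> b \<oplus> a)"
    using *[of "vx \<oplus> vy" "vy \<oplus> vx"] by (simp add: E_CR_def)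
  show "derivable E (a \<oplus> \<zero> \<approx> a)"
    using *[of "vx \<oplus> \<zero>" vx] by (simp add: E_CR_def)
  show "derivable E (a \<oplus> (\<ominus> a) \<approx> \<zero>)"
    using *[of "vx \<oplus> (\<ominus> vx)" \<zero>] by (simp add: E_CR_def)
  show "derivable E ((a \<otimes> b) \<otimes> c \<approx> a \<otimes> (b \<otimes> c))"
    using *[of "(vx \<otimes> vy) \<otimes> vz" "vx \<otimes> (vy \<otimes> vz)"] by (simp add: E_CR_def)
  show "derivable E (a \<otimes> b \<approx> b \<otimes> a)"
    using *[of "vx \<otimes> vy" "vy \<otimes> vx"] by (simp add: E_CR_def)
  show "derivable E (a \<otimes> \<one> \<approx> a)"
    using *[of "vx \<otimes> \<one>" vx] by (simp add: E_CR_def)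
  show "derivable E (a \<otimes> (b \<oplus> c) \<approx> a \<otimes> b \<oplus> a \<otimes> c)"
    using *[of "vx \<otimes> (vy \<oplus> vz)" "vx \<otimes> vy \<oplus> vx \<otimes> vz"] by (simp add: E_CR_def)
qed

instantiation term_class :: (ring_theory) "{comm_ring, comm_monoid_mult}"
begin

lift_definition zero_term_class :: "'a term_class" is \<zero> .

lift_definition one_term_class :: "'a term_class" is \<one> .

lift_definition plus_term_class :: "'a term_class \<Rightarrow> 'a term_class \<Rightarrow> 'a term_class" is Add
  by (rule derivable.cong_Add)

lift_definition times_term_class :: "'a term_class \<Rightarrow> 'a term_class \<Rightarrow> 'a term_class" is Mul
  by (rule derivable.cong_Mul)

lift_definition uminus_term_class :: "'a term_class \<Rightarrow> 'a term_class" is Neg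
  by (rule derivable.cong_Neg)

lift_definition minus_term_class :: "'a term_class \<Rightarrow> 'a term_class \<Rightarrow> 'a term_class" is Sub
  by (intro derivable.cong_Add derivable.cong_Neg)

instance
proof
  note CR = derivable_CR[OF E_CR_subset]
  fix a b c :: "'a term_class"
  show add_assoc: "a + b + c = a + (b + c)"
    by transfer (rule CR)
  show add_commute: "a + b = b + a" for a b :: "'a term_class"
    by transfer (rule CR)
  have "a + 0 = a"
    by transfer (rule CR)
  then show "0 + a = a"
    by (simp only: add_commute)
  have "a + - a = 0"
    by transfer (rule CR)
  then show "- a + a = 0"
    by (simp only: add_commute)
  show "a - b = a + - b"
    by transfer (rule derivable.refl)
  show "a * b * c = a * (b * c)"
    by transfer (rule CR)
  show mult_commute: "a * b = b * a" for a b :: "'a term_class"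
    by transfer (rule CR)
  have "a * 1 = a"
    by transfer (rule CR)
  then show "1 * a = a"
    by (simp only: mult_commute)
  have "c * (a + b) = c * a + c * b"
    by transfer (rule CR)
  then show "(a + b) * c = a * c + b * c"
    by (simp only: mult_commute)
qed

end

lift_definition inv_class :: "'a :: ring_theory term_class \<Rightarrow> 'a term_class" is Inv
  by (rule derivable.cong_Inv)

lift_definition tilde_class :: "'a :: ring_theory term_class \<Rightarrow> 'a term_class" is Tilde
  by (rule derivable.cong_Tilde)

section \<open>The two theories\<close>

datatype md = Md

instantiation md :: ring_theory
begin

definition axs_md :: "md itself \<Rightarrow> equation set"
  where "axs_md _ = E_Md \<union> {vx\<^sup>\<sim> \<approx> vx\<inverse> \<oplus> (\<one> \<ominus> vx \<otimes> vx\<inverse>)}"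

instance
  by standard (auto simp: axs_md_def E_Md_def)

end

datatype nimd1 = NiMd1

instantiation nimd1 :: ring_theory
begin

definition axs_nimd1 :: "nimd1 itself \<Rightarrow> equation set"
  where "axs_nimd1 _ = E_NiMd1 \<union> {vx\<inverse> \<approx> vx \<otimes> (vx\<^sup>\<sim> \<otimes> vx\<^sup>\<sim>)}"

instance
  by standard (auto simp: axs_nimd1_def E_NiMd1_def)

end

interpretation md: meadow "inv_class :: md term_class \<Rightarrow> _"
proof
  fix x :: "md term_class"
  show "inv_class (inv_class x) = x"
  proof transfer
    fix a
    show "derivable (axs TYPE(md)) ((a\<inverse>)\<inverse> \<approx> a)"
      \<comment> \<open>Only \<open>vx\<close> occurs in the axiom, so a constant substitution is
        enough.\<close>
      using derivable_inst[of "(vx\<inverse>)\<inverse>" vx "axs TYPE(md)" "\<lambda>_. a"]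
      by (simp add: axs_md_def E_Md_def)
  qed
  show "x * (x * inv_class x) = x"
  proof transfer
    fix a
    show "derivable (axs TYPE(md)) (a \<otimes> (a \<otimes> a\<inverse>) \<approx> a)"
      using derivable_inst[of "vx \<otimes> (vx \<otimes> vx\<inverse>)" vx "axs TYPE(md)" "\<lambda>_. a"]
      by (simp add: axs_md_def E_Md_def)
  qed
qed

text \<open>The equation added to \<open>E_Md\<close> holds in the term algebra, so the results on
  \<open>md.one_based\<close> carry over to the syntactic operator.\<close>

lemma tilde_class_md: "tilde_class = (md.one_based :: md term_class \<Rightarrow> _)"
proof
  fix x :: "md term_class"
  show "tilde_class x = md.one_based x"
    unfolding md.one_based_def
  proof transfer
    fix a
    show "derivable (axs TYPE(md)) (a\<^sup>\<sim> \<approx> a\<inverse> \<oplus> (\<one> \<ominus> a \<otimes> a\<inverse>))"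
      using derivable_inst[of "vx\<^sup>\<sim>" "vx\<inverse> \<oplus> (\<one> \<ominus> vx \<otimes> vx\<inverse>)" "axs TYPE(md)" "\<lambda>_. a"]
      by (simp add: axs_md_def)
  qed
qed

interpretation nimd1: one_based_meadow "tilde_class :: nimd1 term_class \<Rightarrow> _"
proof
  have *: "derivable (axs TYPE(nimd1)) (subst (\<lambda>_. a) s, subst (\<lambda>_. a) t)"
    if "(s, t) \<in> E_NiMd1" for s t a
    using that by (intro derivable_inst) (simp add: axs_nimd1_def)
  fix x :: "nimd1 term_class"
  show "tilde_class (tilde_class x) = x + (1 - x * tilde_class x)"
  proof transfer
    fix a
    show "derivable (axs TYPE(nimd1)) ((a\<^sup>\<sim>)\<^sup>\<sim> \<approx> a \<oplus> (\<one> \<ominus> a \<otimes> a\<^sup>\<sim>))"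
      using *[of "(vx\<^sup>\<sim>)\<^sup>\<sim>" "vx \<oplus> (\<one> \<ominus> vx \<otimes> vx\<^sup>\<sim>)" a] by (simp add: E_NiMd1_def)
  qed
  show "x * (x * tilde_class x) = x"
  proof transfer
    fix a
    show "derivable (axs TYPE(nimd1)) (a \<otimes> (a \<otimes> a\<^sup>\<sim>) \<approx> a)"
      using *[of "vx \<otimes> (vx \<otimes> vx\<^sup>\<sim>)" vx a] by (simp add: E_NiMd1_def)
  qed
  show "tilde_class x * tilde_class (tilde_class x) = 1"
  proof transfer
    fix a
    show "derivable (axs TYPE(nimd1)) (a\<^sup>\<sim> \<otimes> (a\<^sup>\<sim>)\<^sup>\<sim> \<approx> \<one>)"
      using *[of "vx\<^sup>\<sim> \<otimes> (vx\<^sup>\<sim>)\<^sup>\<sim>" \<one> a] by (simp add: E_NiMd1_def)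
  qed
  show "tilde_class (x * (tilde_class x * tilde_class x)) * (x * tilde_class x) = x"
  proof transfer
    fix a
    show "derivable (axs TYPE(nimd1)) ((a \<otimes> (a\<^sup>\<sim> \<otimes> a\<^sup>\<sim>))\<^sup>\<sim> \<otimes> (a \<otimes> a\<^sup>\<sim>) \<approx> a)"
      using *[of "(vx \<otimes> (vx\<^sup>\<sim> \<otimes> vx\<^sup>\<sim>))\<^sup>\<sim> \<otimes> (vx \<otimes> vx\<^sup>\<sim>)" vx a]
      by (simp add: E_NiMd1_def)
  qed
qed

text \<open>Dually, the equation added to \<open>E_NiMd1\<close> makes the results on
  \<open>nimd1.involutive\<close> available for the syntactic inverse.\<close>

lemma inv_class_nimd1: "inv_class = (nimd1.involutive :: nimd1 term_class \<Rightarrow> _)"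
proof
  fix x :: "nimd1 term_class"
  show "inv_class x = nimd1.involutive x"
    unfolding nimd1.involutive_def
  proof transfer
    fix a
    show "derivable (axs TYPE(nimd1)) (a\<inverse> \<approx> a \<otimes> (a\<^sup>\<sim> \<otimes> a\<^sup>\<sim>))"
      using derivable_inst[of "vx\<inverse>" "vx \<otimes> (vx\<^sup>\<sim> \<otimes> vx\<^sup>\<sim>)" "axs TYPE(nimd1)" "\<lambda>_. a"]
      by (simp add: axs_nimd1_def)
  qed
qed

lemma derivable_iff_abs_eq:
  "derivable (axs TYPE('a :: ring_theory)) (s \<approx> t) \<longleftrightarrow>
    (abs_term_class s :: 'a term_class) = abs_term_class t"
  by (simp add: term_class.abs_eq_iff)

text \<open>Oriented to push \<open>abs_term_class\<close> down to the variables, whose classes then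
  serve as the elements to which the algebraic identities are applied.\<close>

lemmas abs_term_class_simps =
  plus_term_class.abs_eq[symmetric] times_term_class.abs_eq[symmetric]
  uminus_term_class.abs_eq[symmetric] one_term_class.abs_eq[symmetric]
  inv_class.abs_eq[symmetric] tilde_class.abs_eq[symmetric]

lemma entails_md:
  "axs TYPE(md) \<turnstile> E_NiMd1 \<union> {vx\<inverse> \<approx> vx \<otimes> (vx\<^sup>\<sim> \<otimes> vx\<^sup>\<sim>)}"
proof -
  have "derivable (axs TYPE(md)) e" if "e \<in> E_CR" for e
    using that E_CR_subset by (intro derivable.ax) auto
  moreover have "derivable (axs TYPE(md)) ((vx\<^sup>\<sim>)\<^sup>\<sim> \<approx> vx \<oplus> (\<one> \<ominus> vx \<otimes> vx\<^sup>\<sim>))"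
    using md.one_based_one_based
    by (simp add: derivable_iff_abs_eq abs_term_class_simps tilde_class_md)
  moreover have "derivable (axs TYPE(md)) (vx \<otimes> (vx \<otimes> vx\<^sup>\<sim>) \<approx> vx)"
    by (simp add: derivable_iff_abs_eq abs_term_class_simps tilde_class_md md.mult_one_based
        md.mult_mult_inv)
  moreover have "derivable (axs TYPE(md)) (vx\<^sup>\<sim> \<otimes> (vx\<^sup>\<sim>)\<^sup>\<sim> \<approx> \<one>)"
    using md.one_based_mult_one_based
    by (simp add: derivable_iff_abs_eq abs_term_class_simps tilde_class_md)
  moreover have "derivable (axs TYPE(md)) ((vx \<otimes> (vx\<^sup>\<sim> \<otimes> vx\<^sup>\<sim>))\<^sup>\<sim> \<otimes> (vx \<otimes> vx\<^sup>\<sim>) \<approx> vx)"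
    using md.one_based_inv_mult
    by (simp add: derivable_iff_abs_eq abs_term_class_simps tilde_class_md)
  moreover have "derivable (axs TYPE(md)) (vx\<inverse> \<approx> vx \<otimes> (vx\<^sup>\<sim> \<otimes> vx\<^sup>\<sim>))"
    using md.inv_eq_one_based
    by (simp add: derivable_iff_abs_eq abs_term_class_simps tilde_class_md)
  ultimately show ?thesis
    by (auto simp: entails_def E_NiMd1_def)
qed

lemma entails_nimd1:
  "axs TYPE(nimd1) \<turnstile> E_Md \<union> {vx\<^sup>\<sim> \<approx> vx\<inverse> \<oplus> (\<one> \<ominus> vx \<otimes> vx\<inverse>)}"
proof -
  have "derivable (axs TYPE(nimd1)) e" if "e \<in> E_CR" for e
    using that E_CR_subset by (intro derivable.ax) auto
  moreover have "derivable (axs TYPE(nimd1)) ((vx\<inverse>)\<inverse> \<approx> vx)"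
    by (simp add: derivable_iff_abs_eq abs_term_class_simps inv_class_nimd1
        nimd1.involutive_involutive)
  moreover have "derivable (axs TYPE(nimd1)) (vx \<otimes> (vx \<otimes> vx\<inverse>) \<approx> vx)"
    by (simp add: derivable_iff_abs_eq abs_term_class_simps inv_class_nimd1
        nimd1.mult_mult_involutive)
  moreover have "derivable (axs TYPE(nimd1)) (vx\<^sup>\<sim> \<approx> vx\<inverse> \<oplus> (\<one> \<ominus> vx \<otimes> vx\<inverse>))"
    using nimd1.til_eq_involutive
    by (simp add: derivable_iff_abs_eq abs_term_class_simps inv_class_nimd1)
  ultimately show ?thesis
    by (auto simp: entails_def E_Md_def)
qed

theorem theorem3:
  shows "(E_Md \<union> {vx\<^sup>\<sim> \<approx> vx\<inverse> \<oplus> (\<one> \<ominus> vx \<otimes> vx\<inverse>)}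
           \<turnstile> E_NiMd1 \<union> {vx\<inverse> \<approx> vx \<otimes> (vx\<^sup>\<sim> \<otimes> vx\<^sup>\<sim>)})
       \<and> (E_NiMd1 \<union> {vx\<inverse> \<approx> vx \<otimes> (vx\<^sup>\<sim> \<otimes> vx\<^sup>\<sim>)}
           \<turnstile> E_Md \<union> {vx\<^sup>\<sim> \<approx> vx\<inverse> \<oplus> (\<one> \<ominus> vx \<otimes> vx\<inverse>)})"
  using entails_md entails_nimd1 unfolding axs_md_def axs_nimd1_def by (rule conjI)

end
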